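(* For every integer $n>3$, the $1$-subdivision of the complete graph $K_n$ is not norming.
   Context: The $1$-subdivision of a graph $G$ is obtained by replacing each edge of $G$ by a path of length two; it is bipartite with bipartition (original vertices, subdividing vertices). For a bipartite graph $H$ with bipartition $A\cup B$ and edges $(u,v)$, $u\in A$, $v\in B$, let $t_H(f)=\int\prod_{(u,v)\in E(H)}f(x_u,y_v)$ for bounded measurable $f:[0,1]^2\to\mathbb{R}$ (variables $x_u,y_v\in[0,1]$, Lebesgue measure). $H$ is norming (= real-norming) if $f\mapsto|t_H(f)|^{1/|E(H)|}$ is a seminorm on the space of such $f$ vanishing only on functions that are $0$ a.e. (This property does not depend on which side is called $A$.) *)

theory Defs
  imports "HOL-Analysis.Analysis"
begin

record 'v ugraph =
  verts :: "'v set"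
  uedges :: "'v set set"

definition complete_graph :: "nat \<Rightarrow> nat ugraph" where
  "complete_graph n = \<lparr>verts = {..<n}, uedges = {e. e \<subseteq> {..<n} \<and> card e = 2}\<rparr>"

text \<open>
  A bipartite graph is given together with its bipartition; the edge between
  \<open>u\<close> on the left and \<open>v\<close> on the right is the pair \<open>(u, v)\<close>.
\<close>

record ('a, 'b) bigraph =
  lverts :: "'a set"
  rverts :: "'b set"
  biedges :: "('a \<times> 'b) set"

definition bigraph_wf :: "('a, 'b) bigraph \<Rightarrow> bool" where
  "bigraph_wf H \<longleftrightarrow> finite (lverts H) \<and> finite (rverts H) \<and> biedges H \<subseteq> lverts H \<times> rverts H"

text \<open>
  The vertex subdividing the edge \<open>e = {u, v}\<close> is \<open>e\<close> itself; it is joined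
  to \<open>u\<close> and \<open>v\<close>, which gives the path of length two replacing \<open>e\<close>.
\<close>

definition one_subdivision :: "'v ugraph \<Rightarrow> ('v, 'v set) bigraph" where
  "one_subdivision G =
     \<lparr>lverts = verts G, rverts = uedges G, biedges = {(v, e). e \<in> uedges G \<and> v \<in> e}\<rparr>"

lemma bigraph_wf_one_subdivision_complete: "bigraph_wf (one_subdivision (complete_graph n))"
  by (auto simp: bigraph_wf_def one_subdivision_def complete_graph_def)

definition unit_square :: "(real \<times> real) set" where
  "unit_square = {0..1} \<times> {0..1}"

definition bounded_measurable :: "(real \<times> real \<Rightarrow> real) set" where
  "bounded_measurable =
     {f. f \<in> borel_measurable (lebesgue_on unit_square) \<and> bounded (f ` unit_square)}"

text \<open>
  A finite product of complete measure spaces need not be complete, so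
  \<open>f (x u, y v)\<close> need not be measurable for the product measure itself when \<open>f\<close>
  is only Lebesgue measurable. Its completion is the Lebesgue measure on the
  unit cube with one coordinate for each vertex.
\<close>

definition vertex_cube :: "('a, 'b) bigraph \<Rightarrow> (('a \<Rightarrow> real) \<times> ('b \<Rightarrow> real)) measure" where
  "vertex_cube H = completion
     (Pi\<^sub>M (lverts H) (\<lambda>_. lebesgue_on {0..1}) \<Otimes>\<^sub>M Pi\<^sub>M (rverts H) (\<lambda>_. lebesgue_on {0..1}))"

definition hom_density :: "('a, 'b) bigraph \<Rightarrow> (real \<times> real \<Rightarrow> real) \<Rightarrow> real" where
  "hom_density H f = (\<integral>(x, y). (\<Prod>(u, v)\<in>biedges H. f (x u, y v)) \<partial>vertex_cube H)"

definition graph_norm :: "('a, 'b) bigraph \<Rightarrow> (real \<times> real \<Rightarrow> real) \<Rightarrow> real" where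
  "graph_norm H f = \<bar>hom_density H f\<bar> powr (1 / real (card (biedges H)))"

definition seminorm_on :: "('c \<Rightarrow> real) set \<Rightarrow> (('c \<Rightarrow> real) \<Rightarrow> real) \<Rightarrow> bool" where
  "seminorm_on L N \<longleftrightarrow>
     (\<forall>f\<in>L. 0 \<le> N f) \<and>
     (\<forall>f\<in>L. \<forall>c. N (\<lambda>p. c * f p) = \<bar>c\<bar> * N f) \<and>
     (\<forall>f\<in>L. \<forall>g\<in>L. N (\<lambda>p. f p + g p) \<le> N f + N g)"

definition norming :: "('a, 'b) bigraph \<Rightarrow> bool" where
  "norming H \<longleftrightarrow>
     seminorm_on bounded_measurable (graph_norm H) \<and>
     (\<forall>f\<in>bounded_measurable. graph_norm H f = 0 \<longrightarrow> (AE p in lebesgue_on unit_square. f p = 0))"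

end

theory Submission
  imports "HOL-Probability.Infinite_Product_Measure" Defs
begin

text \<open>
  Write \<open>t(W)\<close> for the density of \<open>K\<^sub>n\<close> in a kernel \<open>W\<close>, so that the density of the subdivision in
  \<open>f\<close> is \<open>t(W)\<close> with \<open>W(x, x') = \<integral> f(x, y) f(x', y) dy\<close>. If \<open>f\<close> and \<open>g\<close> have disjoint supports
  in \<open>y\<close>, then \<open>f + g\<close> and \<open>f - g\<close> have the same density, and the triangle inequality for
  \<open>2 f = (f + g) + (f - g)\<close> shows that adding a positive semidefinite kernel \<open>\<psi> \<otimes> \<psi>\<close> to the positive
  semidefinite kernel \<open>W\<close> cannot decrease \<open>\<bar>t(W)\<bar>\<close>.

  This fails. Let \<open>W(x, x') = 1 + x \<bullet> x'\<close> on seven points of the plane, where the origin has mass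
  \<open>1 - 6 \<delta>\<close> and the others have mass \<open>\<delta>\<close>. The derivative of \<open>t(W + s \<psi> \<otimes> \<psi>)\<close> at \<open>s = 0\<close> is a sum over
  the edges of \<open>K\<^sub>n\<close> of sums of \<open>\<delta>\<^sup>2 (\<Sum>x. \<psi>(x) \<Prod>w. W(x, w))\<^sup>2\<close>, where \<open>w\<close> ranges over the images of the
  \<open>n - 2\<close> other vertices, weighted by the product of the \<open>W(w, w')\<close>. If \<open>\<psi>\<close> annihilates affine functions,
  at least two of the \<open>w\<close> must differ from the origin, so for small \<open>\<delta>\<close> the sign is that of
  \<open>\<Sum>w w'. W(w, w') (w\<^sup>T \<Phi> w')\<^sup>2\<close> with \<open>\<Phi> = \<Sum>x. \<psi>(x) x x\<^sup>T\<close>, and this is negative when \<open>\<Phi>\<close> is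
  indefinite and the third moments of the points are suitable.
\<close>

section \<open>Densities of step functions\<close>

lemma prob_space_unit_interval: "prob_space (lebesgue_on {0..1::real})"
  by (rule prob_spaceI) (simp add: emeasure_restrict_space)

text \<open>The integrand is constant on boxes indexed by a colouring \<open>c\<close> of the left
  and a colouring \<open>d\<close> of the right vertices, so the integral is a finite double sum.
  For fixed \<open>c\<close> each edge involves the colour of only one right vertex, so the sum over
  \<open>d\<close> factorises over \<open>rverts H\<close>.\<close>

lemma hom_density_step:
  fixes H :: "('a, 'b) bigraph" and M :: "'i \<Rightarrow> 'j \<Rightarrow> real"
  assumes wf: "bigraph_wf H" and fin: "finite I" "finite J"
    and k: "k \<in> lebesgue_on {0..1} \<rightarrow>\<^sub>M count_space I"
    and l: "l \<in> lebesgue_on {0..1} \<rightarrow>\<^sub>M count_space J"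
  defines "a \<equiv> \<lambda>i. measure (lebesgue_on {0..1}) (k -` {i} \<inter> {0..1::real})"
  defines "b \<equiv> \<lambda>j. measure (lebesgue_on {0..1}) (l -` {j} \<inter> {0..1::real})"
  shows "hom_density H (\<lambda>(x, y). M (k x) (l y)) =
    (\<Sum>c\<in>lverts H \<rightarrow>\<^sub>E I. (\<Prod>u\<in>lverts H. a (c u)) *
      (\<Prod>v\<in>rverts H. \<Sum>j\<in>J. b j * (\<Prod>u | (u, v) \<in> biedges H. M (c u) j)))"
proof -
  define X where "X = lebesgue_on {0..1::real}"
  interpret X: prob_space X
    unfolding X_def by (rule prob_space_unit_interval)
  define L R E where "L = lverts H" and "R = rverts H" and "E = biedges H"
  have finL: "finite L" and finR: "finite R" and E: "E \<subseteq> L \<times> R"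
    using wf by (auto simp: bigraph_wf_def L_def R_def E_def)
  have spX: "space X = {0..1}"
    by (simp add: X_def)
  interpret PX: product_prob_space "\<lambda>_. X" UNIV ..
  let ?P = "Pi\<^sub>M L (\<lambda>_. X)" and ?Q = "Pi\<^sub>M R (\<lambda>_. X)"
  interpret P: prob_space ?P by (intro prob_space_PiM X.prob_space_axioms)
  interpret Q: prob_space ?Q by (intro prob_space_PiM X.prob_space_axioms)
  interpret PQ: pair_prob_space ?P ?Q ..
  define kc lc where "kc = (\<lambda>i. k -` {i} \<inter> space X)" and "lc = (\<lambda>j. l -` {j} \<inter> space X)"
  have kc: "kc i \<in> sets X" if "i \<in> I" for i
    using that k unfolding kc_def X_def by (intro measurable_sets) auto
  have lc: "lc i \<in> sets X" if "i \<in> J" for i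
    using that l unfolding lc_def X_def by (intro measurable_sets) auto
  have kI: "k x \<in> I" if "x \<in> space X" for x
    using measurable_space[OF k] that by (auto simp: X_def)
  have lJ: "l x \<in> J" if "x \<in> space X" for x
    using measurable_space[OF l] that by (auto simp: X_def)
  define m where "m = (\<lambda>c d. \<Prod>(u, v)\<in>E. M (c u) (d v))"
  define box where "box = (\<lambda>c d. (\<Pi>\<^sub>E u\<in>L. kc (c u)) \<times> (\<Pi>\<^sub>E v\<in>R. lc (d v)))"
  have boxL: "(\<Pi>\<^sub>E u\<in>L. kc (c u)) \<in> sets ?P" if "c \<in> L \<rightarrow>\<^sub>E I" for c
    using that by (intro sets_PiM_I_finite finL kc) auto
  have boxR: "(\<Pi>\<^sub>E v\<in>R. lc (d v)) \<in> sets ?Q" if "d \<in> R \<rightarrow>\<^sub>E J" for d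
    using that by (intro sets_PiM_I_finite finR lc) auto
  have box_sets: "box c d \<in> sets (?P \<Otimes>\<^sub>M ?Q)" if "c \<in> L \<rightarrow>\<^sub>E I" "d \<in> R \<rightarrow>\<^sub>E J" for c d
    unfolding box_def using that by (intro pair_measureI boxL boxR)
  have meas_box: "measure (?P \<Otimes>\<^sub>M ?Q) (box c d) = (\<Prod>u\<in>L. a (c u)) * (\<Prod>v\<in>R. b (d v))"
    if c: "c \<in> L \<rightarrow>\<^sub>E I" and d: "d \<in> R \<rightarrow>\<^sub>E J" for c d
  proof -
    have "emeasure ?P (\<Pi>\<^sub>E u\<in>L. kc (c u)) = (\<Prod>u\<in>L. emeasure X (kc (c u)))"
      using c by (intro PX.emeasure_PiM finL kc) auto
    then have 1: "emeasure ?P (\<Pi>\<^sub>E u\<in>L. kc (c u)) = ennreal (\<Prod>u\<in>L. a (c u))"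
      by (simp add: X.emeasure_eq_measure prod_ennreal a_def kc_def spX flip: X_def)
    have "emeasure ?Q (\<Pi>\<^sub>E v\<in>R. lc (d v)) = (\<Prod>v\<in>R. emeasure X (lc (d v)))"
      using d by (intro PX.emeasure_PiM finR lc) auto
    then have 2: "emeasure ?Q (\<Pi>\<^sub>E v\<in>R. lc (d v)) = ennreal (\<Prod>v\<in>R. b (d v))"
      by (simp add: X.emeasure_eq_measure prod_ennreal b_def lc_def spX flip: X_def)
    have "emeasure (?P \<Otimes>\<^sub>M ?Q) (box c d) = ennreal (\<Prod>u\<in>L. a (c u)) * ennreal (\<Prod>v\<in>R. b (d v))"
      unfolding box_def by (subst Q.emeasure_pair_measure_Times[OF boxL[OF c] boxR[OF d]]) (simp only: 1 2)
    then show ?thesis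
      by (simp add: measure_def enn2real_mult prod_nonneg a_def b_def)
  qed
  define S where "S = (\<lambda>\<omega>. \<Sum>c\<in>L \<rightarrow>\<^sub>E I. \<Sum>d\<in>R \<rightarrow>\<^sub>E J. m c d * indicator (box c d) \<omega>)"
  have S: "(case \<omega> of (x, y) \<Rightarrow> \<Prod>(u, v)\<in>E. (case (x u, y v) of (x, y) \<Rightarrow> M (k x) (l y))) = S \<omega>"
    if \<omega>: "\<omega> \<in> space (?P \<Otimes>\<^sub>M ?Q)" for \<omega>
  proof -
    obtain x y where xy: "\<omega> = (x, y)" "x \<in> L \<rightarrow>\<^sub>E space X" "y \<in> R \<rightarrow>\<^sub>E space X"
      using \<omega> by (auto simp: space_pair_measure space_PiM)
    \<comment> \<open>Each point lies in the box of exactly one pair of colourings, the one read off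
      from its coordinates.\<close>
    define c0 d0 where "c0 = restrict (k \<circ> x) L" and "d0 = restrict (l \<circ> y) R"
    have c0: "c0 \<in> L \<rightarrow>\<^sub>E I" and d0: "d0 \<in> R \<rightarrow>\<^sub>E J"
      using xy(2,3) by (auto simp: c0_def d0_def intro!: kI lJ)
    have "indicator (box c d) \<omega> = (if c = c0 then if d = d0 then 1 else 0 else (0::real))"
      if c: "c \<in> L \<rightarrow>\<^sub>E I" and d: "d \<in> R \<rightarrow>\<^sub>E J" for c d
    proof -
      have "x \<in> (\<Pi>\<^sub>E u\<in>L. kc (c u)) \<longleftrightarrow> c = c0"
        using xy(2) c c0 by (auto simp: kc_def c0_def PiE_iff extensional_def fun_eq_iff)
      moreover have "y \<in> (\<Pi>\<^sub>E v\<in>R. lc (d v)) \<longleftrightarrow> d = d0"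
        using xy(3) d d0 by (auto simp: lc_def d0_def PiE_iff extensional_def fun_eq_iff)
      ultimately show ?thesis
        by (auto simp: box_def xy(1) indicator_def)
    qed
    then have "S \<omega> = (\<Sum>c\<in>L \<rightarrow>\<^sub>E I. \<Sum>d\<in>R \<rightarrow>\<^sub>E J. if c = c0 then if d = d0 then m c d else 0 else 0)"
      unfolding S_def by (intro sum.cong) auto
    also have "\<dots> = (\<Sum>c\<in>L \<rightarrow>\<^sub>E I. if c = c0 then m c d0 else 0)"
      using d0 finR fin by (intro sum.cong) (auto simp: sum.delta finite_PiE)
    also have "\<dots> = m c0 d0"
      using c0 finL fin by (auto simp: sum.delta finite_PiE)
    also have "\<dots> = (\<Prod>(u, v)\<in>E. M (k (x u)) (l (y v)))"
      unfolding m_def using E by (intro prod.cong) (auto simp: c0_def d0_def)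
    finally show ?thesis
      by (simp add: xy(1))
  qed
  have "hom_density H (\<lambda>(x, y). M (k x) (l y)) = integral\<^sup>L (completion (?P \<Otimes>\<^sub>M ?Q)) S"
    unfolding hom_density_def vertex_cube_def
    by (intro Bochner_Integration.integral_cong) (use S in \<open>auto simp: X_def L_def R_def E_def\<close>)
  \<comment> \<open>A finite combination of indicators of measurable boxes is measurable before
    completion, so the completion does not affect the integral.\<close>
  also have "\<dots> = integral\<^sup>L (?P \<Otimes>\<^sub>M ?Q) S"
    unfolding S_def using box_sets by (intro integral_completion) auto
  also have "\<dots> = (\<Sum>c\<in>L \<rightarrow>\<^sub>E I. \<Sum>d\<in>R \<rightarrow>\<^sub>E J. m c d * measure (?P \<Otimes>\<^sub>M ?Q) (box c d))"
  proof -
    have "has_bochner_integral (?P \<Otimes>\<^sub>M ?Q) S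
       (\<Sum>c\<in>L \<rightarrow>\<^sub>E I. \<Sum>d\<in>R \<rightarrow>\<^sub>E J. m c d * measure (?P \<Otimes>\<^sub>M ?Q) (box c d))"
      unfolding S_def
      by (intro has_bochner_integral_sum has_bochner_integral_mult_right
           has_bochner_integral_real_indicator box_sets) (auto simp: PQ.P.emeasure_eq_measure)
    then show ?thesis
      by (rule has_bochner_integral_integral_eq)
  qed
  also have "\<dots> = (\<Sum>c\<in>L \<rightarrow>\<^sub>E I. (\<Prod>u\<in>L. a (c u)) *
      (\<Prod>v\<in>R. \<Sum>j\<in>J. b j * (\<Prod>u | (u, v) \<in> E. M (c u) j)))"
  proof (intro sum.cong refl)
    fix c assume c: "c \<in> L \<rightarrow>\<^sub>E I"
    have m: "m c d = (\<Prod>v\<in>R. \<Prod>u | (u, v) \<in> E. M (c u) (d v))" for d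
    proof -
      have "m c d = (\<Prod>(v, u)\<in>(SIGMA v:R. {u. (u, v) \<in> E}). M (c u) (d v))"
        unfolding m_def
        by (rule prod.reindex_bij_witness[of _ prod.swap prod.swap]) (use E in auto)
      also have "\<dots> = (\<Prod>v\<in>R. \<Prod>u | (u, v) \<in> E. M (c u) (d v))"
        using E finL finR by (intro prod.Sigma[symmetric]) (auto intro: finite_subset[of _ L])
      finally show ?thesis .
    qed
    have "(\<Sum>d\<in>R \<rightarrow>\<^sub>E J. m c d * measure (?P \<Otimes>\<^sub>M ?Q) (box c d)) =
       (\<Prod>u\<in>L. a (c u)) * (\<Sum>d\<in>R \<rightarrow>\<^sub>E J. \<Prod>v\<in>R. b (d v) * (\<Prod>u | (u, v) \<in> E. M (c u) (d v)))"
      unfolding sum_distrib_left using c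
      by (intro sum.cong) (auto simp: meas_box m prod.distrib)
    also have "(\<Sum>d\<in>R \<rightarrow>\<^sub>E J. \<Prod>v\<in>R. b (d v) * (\<Prod>u | (u, v) \<in> E. M (c u) (d v))) =
       (\<Prod>v\<in>R. \<Sum>j\<in>J. b j * (\<Prod>u | (u, v) \<in> E. M (c u) j))"
      using finR fin by (subst prod_sum_PiE) auto
    finally show "(\<Sum>d\<in>R \<rightarrow>\<^sub>E J. m c d * measure (?P \<Otimes>\<^sub>M ?Q) (box c d)) =
      (\<Prod>u\<in>L. a (c u)) * (\<Prod>v\<in>R. \<Sum>j\<in>J. b j * (\<Prod>u | (u, v) \<in> E. M (c u) j))" .
  qed
  finally show ?thesis
    by (simp add: L_def R_def E_def)
qed

text \<open>The cap at \<open>N\<close> gathers everything from \<open>N * \<delta>\<close> onwards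
  into one last cell. With \<open>N = 6\<close> this large cell is the origin and the other six
  carry mass \<delta>; with \<open>N = 3\<close> and length \<open>1/4\<close> all four cells are
  equal.\<close>

definition cell :: "nat \<Rightarrow> real \<Rightarrow> real \<Rightarrow> nat" where
  "cell N \<delta> x = min N (nat \<lfloor>x / \<delta>\<rfloor>)"

lemma cell_measurable_borel: "cell N \<delta> \<in> borel \<rightarrow>\<^sub>M count_space UNIV"
  unfolding cell_def by measurable

lemma cell_measurable: "cell N \<delta> \<in> lebesgue_on {0..1} \<rightarrow>\<^sub>M count_space {..N}"
proof -
  have "cell N \<delta> \<in> lebesgue_on {0..1} \<rightarrow>\<^sub>M count_space UNIV"
    using cell_measurable_borel by (intro measurable_restrict_space1 measurable_completion) simp
  then have "cell N \<delta> -` {i} \<inter> space (lebesgue_on {0..1}) \<in> sets (lebesgue_on {0..1})" for i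
    by (rule measurable_sets) simp
  moreover have "cell N \<delta> \<in> space (lebesgue_on {0..1}) \<rightarrow> {..N}"
    by (simp add: cell_def)
  ultimately show ?thesis
    by (simp add: measurable_count_space_eq2)
qed

lemma measure_cell:
  fixes \<delta> :: real and N i :: nat
  assumes \<delta>: "\<delta> > 0" "N * \<delta> \<le> 1" and i: "i \<le> N"
  shows "measure (lebesgue_on {0..1}) (cell N \<delta> -` {i} \<inter> {0..1}) = (if i < N then \<delta> else 1 - N * \<delta>)"
proof (cases "i < N")
  case True
  then have "(real i + 1) * \<delta> \<le> N * \<delta>"
    using \<delta> by (intro mult_right_mono) auto
  then have le: "(real i + 1) * \<delta> \<le> 1"
    using \<delta>(2) by (rule order_trans)
  have nonneg: "0 \<le> real i * \<delta>"
    using \<delta> by simp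
  have cell_iff: "cell N \<delta> x = i \<longleftrightarrow> real i * \<delta> \<le> x \<and> x < (real i + 1) * \<delta>" if "0 \<le> x" for x
  proof -
    have "cell N \<delta> x = i \<longleftrightarrow> \<lfloor>x / \<delta>\<rfloor> = int i"
      using True that \<delta> by (auto simp: cell_def min_def)
    also have "\<dots> \<longleftrightarrow> real i * \<delta> \<le> x \<and> x < (real i + 1) * \<delta>"
      using \<delta> by (simp add: floor_eq_iff field_simps)
    finally show ?thesis .
  qed
  have "cell N \<delta> -` {i} \<inter> {0..1} = {real i * \<delta>..<(real i + 1) * \<delta>}"
  proof (rule set_eqI)
    fix x
    show "x \<in> cell N \<delta> -` {i} \<inter> {0..1} \<longleftrightarrow> x \<in> {real i * \<delta>..<(real i + 1) * \<delta>}"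
      using le nonneg cell_iff[of x] by (cases "0 \<le> x") auto
  qed
  moreover have "{real i * \<delta>..<(real i + 1) * \<delta>} \<subseteq> {0..1}"
    using le nonneg by auto
  ultimately show ?thesis
    using True \<delta> by (simp add: measure_restrict_space algebra_simps)
next
  case False
  then have i: "i = N"
    using i by simp
  have nonneg: "0 \<le> real N * \<delta>"
    using \<delta> by simp
  have cell_iff: "cell N \<delta> x = N \<longleftrightarrow> real N * \<delta> \<le> x" if "0 \<le> x" for x
  proof -
    have "cell N \<delta> x = N \<longleftrightarrow> int N \<le> \<lfloor>x / \<delta>\<rfloor>"
      using that \<delta> by (auto simp: cell_def min_def le_nat_iff)
    also have "\<dots> \<longleftrightarrow> real N * \<delta> \<le> x"
      using \<delta> by (simp add: le_floor_iff field_simps)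
    finally show ?thesis .
  qed
  have "cell N \<delta> -` {i} \<inter> {0..1} = {real N * \<delta>..1}"
  proof (rule set_eqI)
    fix x
    show "x \<in> cell N \<delta> -` {i} \<inter> {0..1} \<longleftrightarrow> x \<in> {real N * \<delta>..1}"
      using nonneg cell_iff[of x] unfolding i by (cases "0 \<le> x") auto
  qed
  moreover have "{real N * \<delta>..1} \<subseteq> {0..1}"
    using nonneg by auto
  ultimately show ?thesis
    using \<delta> i by (simp add: measure_restrict_space)
qed

lemma cell_step_bounded_measurable:
  "(\<lambda>(x, y). M (cell N \<delta> x) (cell N' \<delta>' y)) \<in> bounded_measurable"
proof -
  have "(\<lambda>p. M (cell N \<delta> (fst p)) (cell N' \<delta>' (snd p))) \<in> borel_measurable (borel :: (real \<times> real) measure)"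
    (is "?f \<in> _")
  proof -
    have 1: "(\<lambda>p. cell N \<delta> (fst p)) \<in> (borel :: (real \<times> real) measure) \<rightarrow>\<^sub>M count_space UNIV"
      using cell_measurable_borel by (rule measurable_compose[rotated]) (simp flip: borel_prod)
    have 2: "(\<lambda>p. cell N' \<delta>' (snd p)) \<in> (borel :: (real \<times> real) measure) \<rightarrow>\<^sub>M count_space UNIV"
      using cell_measurable_borel by (rule measurable_compose[rotated]) (simp flip: borel_prod)
    show ?thesis
      by (rule measurable_compose_countable[OF _ 1], rule measurable_compose_countable[OF _ 2]) simp
  qed
  then have "?f \<in> borel_measurable (lebesgue_on unit_square)"
    by (intro measurable_restrict_space1 measurable_completion) simp
  moreover have "bounded (?f ` unit_square)"
  proof (rule finite_imp_bounded, rule finite_subset)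
    show "?f ` unit_square \<subseteq> (\<lambda>(i, j). M i j) ` ({..N} \<times> {..N'})"
      by (auto simp: cell_def intro!: image_eqI[where x = "(_, _)"])
  qed simp
  ultimately show ?thesis
    by (simp add: bounded_measurable_def case_prod_unfold)
qed

section \<open>Complete graphs with a deleted edge\<close>

definition pairs :: "'a set \<Rightarrow> 'a set set" where
  "pairs V = {e. e \<subseteq> V \<and> card e = 2}"

lemma finite_pairs: "finite V \<Longrightarrow> finite (pairs V)"
  by (simp add: pairs_def)

lemma pairsE:
  assumes "e \<in> pairs V"
  obtains p q where "e = {p, q}" "p \<noteq> q" "p \<in> V" "q \<in> V"
  using assms by (auto simp: pairs_def card_2_iff)

lemma pairsI: "p \<in> V \<Longrightarrow> q \<in> V \<Longrightarrow> p \<noteq> q \<Longrightarrow> {p, q} \<in> pairs V"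
  by (simp add: pairs_def)

lemma prod_pairs_insert:
  fixes g :: "'a set \<Rightarrow> 'b :: comm_monoid_mult"
  assumes "finite V" "x \<notin> V"
  shows "(\<Prod>e\<in>pairs (insert x V). g e) = (\<Prod>w\<in>V. g {x, w}) * (\<Prod>e\<in>pairs V. g e)"
proof -
  have "pairs (insert x V) = (\<lambda>w. {x, w}) ` V \<union> pairs V"
  proof (intro equalityI subsetI)
    fix e assume "e \<in> pairs (insert x V)"
    then show "e \<in> (\<lambda>w. {x, w}) ` V \<union> pairs V"
      by (elim pairsE) (auto intro: pairsI simp: insert_commute)
  qed (use assms in \<open>auto elim!: pairsE intro!: pairsI\<close>)
  moreover have "(\<lambda>w. {x, w}) ` V \<inter> pairs V = {}"
    using assms by (auto simp: pairs_def)
  moreover have "inj_on (\<lambda>w. {x, w}) V"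
    using assms by (auto simp: inj_on_def doubleton_eq_iff)
  ultimately show ?thesis
    using assms by (simp add: prod.union_disjoint finite_pairs prod.reindex)
qed

lemma sum_PiE_insert:
  fixes f :: "('a \<Rightarrow> 'i) \<Rightarrow> 'b :: comm_monoid_add"
  assumes "x \<notin> S"
  shows "(\<Sum>c\<in>insert x S \<rightarrow>\<^sub>E I. f c) = (\<Sum>i\<in>I. \<Sum>c\<in>S \<rightarrow>\<^sub>E I. f (c(x := i)))"
  unfolding PiE_insert_eq
  by (subst sum.reindex[OF inj_combinator[OF assms]])
     (simp add: sum.cartesian_product case_prod_unfold)

text \<open>The product over \<open>e\<close> avoids choosing an order of the two ends; on a pair it
  is the inner product of the vectors of their colours.\<close>

definition gram :: "'j set \<Rightarrow> ('i \<Rightarrow> 'j \<Rightarrow> real) \<Rightarrow> ('a \<Rightarrow> 'i) \<Rightarrow> 'a set \<Rightarrow> real" where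
  "gram J v c e = (\<Sum>l\<in>J. \<Prod>u\<in>e. v (c u) l)"

lemma gram_pair: "p \<noteq> q \<Longrightarrow> gram J v c {p, q} = (\<Sum>l\<in>J. v (c p) l * v (c q) l)"
  by (simp add: gram_def)

lemma gram_cong: "(\<And>u. u \<in> e \<Longrightarrow> c u = d u) \<Longrightarrow> gram J v c e = gram J v d e"
  unfolding gram_def by (intro sum.cong prod.cong) auto

text \<open>
  Both ends of the deleted edge see the remaining vertices in the same way, so the sum over their
  colours is a square.
\<close>

lemma sum_delete_edge:
  fixes a \<psi> :: "'i \<Rightarrow> real"
  assumes V: "finite V" and e: "e \<in> pairs V"
  shows "(\<Sum>c\<in>V \<rightarrow>\<^sub>E I. (\<Prod>u\<in>V. a (c u)) * ((\<Prod>u\<in>e. \<psi> (c u)) * (\<Prod>e'\<in>pairs V - {e}. gram J v c e'))) =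
    (\<Sum>c\<in>V - e \<rightarrow>\<^sub>E I. (\<Prod>u\<in>V - e. a (c u)) * (\<Prod>e'\<in>pairs (V - e). gram J v c e') *
      (\<Sum>i\<in>I. a i * \<psi> i * (\<Prod>w\<in>V - e. \<Sum>l\<in>J. v i l * v (c w) l))\<^sup>2)"
proof -
  obtain p q where pq: "e = {p, q}" "p \<noteq> q" "p \<in> V" "q \<in> V"
    using e by (rule pairsE)
  define V' where "V' = V - e"
  have V': "finite V'" "p \<notin> V'" "q \<notin> V'" "V = insert p (insert q V')"
    using V pq by (auto simp: V'_def)
  \<comment> \<open>The contribution of one end of the deleted edge when it has colour
    \<open>i\<close> and the remaining vertices are coloured by \<open>c\<close>.\<close>
  define B where "B = (\<lambda>c i. a i * \<psi> i * (\<Prod>w\<in>V'. \<Sum>l\<in>J. v i l * v (c w) l))"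
  have eq: "(\<Prod>u\<in>V. a (d u)) * ((\<Prod>u\<in>e. \<psi> (d u)) * (\<Prod>e'\<in>pairs V - {e}. gram J v d e')) =
      (\<Prod>u\<in>V'. a (c u)) * (\<Prod>e'\<in>pairs V'. gram J v c e') * (B c i * B c j)"
    if d: "d = c(q := j, p := i)" for c i j d
  proof -
    have "(\<Prod>u\<in>V'. a (d u)) = (\<Prod>u\<in>V'. a (c u))"
      using V' by (intro prod.cong) (auto simp: d)
    then have 1: "(\<Prod>u\<in>V. a (d u)) = a i * a j * (\<Prod>u\<in>V'. a (c u))"
      using V' pq by (simp add: d)
    have 2: "(\<Prod>u\<in>e. \<psi> (d u)) = \<psi> i * \<psi> j"
      using pq by (simp add: d)
    \<comment> \<open>Giving the deleted edge the factor 1 turns the product into one over all of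
      \<open>pairs V\<close>, from which \<open>prod_pairs_insert\<close> can split off
      \<open>p\<close> and then \<open>q\<close>.\<close>
    define g where "g = (\<lambda>e'. if e' = e then 1 else gram J v d e')"
    have g: "g {x, w} = (\<Sum>l\<in>J. v (d x) l * v (c w) l)" if "x \<in> e" "w \<in> V'" for x w
    proof -
      have "g {x, w} = gram J v d {x, w}"
        using that V' pq by (auto simp: g_def doubleton_eq_iff)
      also have "\<dots> = (\<Sum>l\<in>J. v (d x) l * v (d w) l)"
        using that by (intro gram_pair) (auto simp: V'_def)
      also have "d w = c w"
        using that V' by (auto simp: d)
      finally show ?thesis .
    qed
    have gp: "(\<Prod>w\<in>V'. g {p, w}) = (\<Prod>w\<in>V'. \<Sum>l\<in>J. v i l * v (c w) l)"
      using pq by (intro prod.cong refl) (subst g, auto simp: d)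
    have gq: "(\<Prod>w\<in>V'. g {q, w}) = (\<Prod>w\<in>V'. \<Sum>l\<in>J. v j l * v (c w) l)"
      using pq by (intro prod.cong refl) (subst g, auto simp: d)
    have gV: "(\<Prod>e'\<in>pairs V'. g e') = (\<Prod>e'\<in>pairs V'. gram J v c e')"
    proof (intro prod.cong refl)
      fix e' assume "e' \<in> pairs V'"
      then have "e' \<subseteq> V'"
        by (simp add: pairs_def)
      then have "g e' = gram J v d e'"
        using V' pq by (auto simp: g_def)
      also have "\<dots> = gram J v c e'"
        using V' \<open>e' \<subseteq> V'\<close> by (intro gram_cong) (auto simp: d)
      finally show "g e' = gram J v c e'" .
    qed
    have "(\<Prod>e'\<in>pairs V - {e}. gram J v d e') = (\<Prod>e'\<in>pairs V - {e}. g e')"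
      by (intro prod.cong) (auto simp: g_def)
    also have "\<dots> = (\<Prod>e'\<in>pairs V. g e')"
      using V by (intro prod.mono_neutral_left) (auto simp: g_def finite_pairs)
    also have "\<dots> = g {p, q} * (\<Prod>w\<in>V'. g {p, w}) * ((\<Prod>w\<in>V'. g {q, w}) * (\<Prod>e'\<in>pairs V'. g e'))"
      using V' pq by (simp add: prod_pairs_insert)
    also have "g {p, q} = 1"
      by (simp add: g_def pq)
    finally show ?thesis
      unfolding 1 2 gp gq gV B_def by (simp add: algebra_simps)
  qed
  have expand: "(\<Sum>c\<in>V \<rightarrow>\<^sub>E I. f c) =
      (\<Sum>i\<in>I. \<Sum>j\<in>I. \<Sum>c\<in>V' \<rightarrow>\<^sub>E I. f (c(q := j, p := i)))" for f :: "('a \<Rightarrow> 'i) \<Rightarrow> real"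
    using V' pq by (simp add: sum_PiE_insert)
  have "(\<Sum>c\<in>V \<rightarrow>\<^sub>E I. (\<Prod>u\<in>V. a (c u)) * ((\<Prod>u\<in>e. \<psi> (c u)) * (\<Prod>e'\<in>pairs V - {e}. gram J v c e'))) =
     (\<Sum>i\<in>I. \<Sum>j\<in>I. \<Sum>c\<in>V' \<rightarrow>\<^sub>E I.
        (\<Prod>u\<in>V'. a (c u)) * (\<Prod>e'\<in>pairs V'. gram J v c e') * (B c i * B c j))"
    by (simp only: expand eq[OF refl])
  also have "\<dots> = (\<Sum>i\<in>I. \<Sum>c\<in>V' \<rightarrow>\<^sub>E I. \<Sum>j\<in>I.
        (\<Prod>u\<in>V'. a (c u)) * (\<Prod>e'\<in>pairs V'. gram J v c e') * (B c i * B c j))"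
    by (intro sum.cong refl sum.swap)
  also have "\<dots> = (\<Sum>c\<in>V' \<rightarrow>\<^sub>E I. \<Sum>i\<in>I. \<Sum>j\<in>I.
        (\<Prod>u\<in>V'. a (c u)) * (\<Prod>e'\<in>pairs V'. gram J v c e') * (B c i * B c j))"
    by (rule sum.swap)
  also have "\<dots> = (\<Sum>c\<in>V' \<rightarrow>\<^sub>E I. (\<Prod>u\<in>V'. a (c u)) * (\<Prod>e'\<in>pairs V'. gram J v c e') *
      (\<Sum>i\<in>I. B c i)\<^sup>2)"
    unfolding power2_eq_square sum_product by (simp only: sum_distrib_left)
  finally show ?thesis
    by (simp add: V'_def B_def)
qed

section \<open>The seven points\<close>

text \<open>
  The first four points carry \<open>psi\<close> and give \<open>\<Phi> = diag(8, -8)\<close>; the points \<open>(\<plusminus>4, 2)\<close> supply the odd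
  moments. Colour \<open>6\<close> is the origin.
\<close>

definition colour_x :: "nat \<Rightarrow> real" where
  "colour_x i = [2, -2, 0, 0, 4, -4, 0] ! i"

definition colour_y :: "nat \<Rightarrow> real" where
  "colour_y i = [0, 0, 2, -2, 2, 2, 0] ! i"

definition colour_vec :: "nat \<Rightarrow> nat \<Rightarrow> real" where
  "colour_vec i l = [1, colour_x i, colour_y i] ! l"

definition psi :: "nat \<Rightarrow> real" where
  "psi i = [1, 1, -1, -1, 0, 0, 0] ! i"

definition colour_weight :: "real \<Rightarrow> nat \<Rightarrow> real" where
  "colour_weight \<delta> i = (if i < 6 then \<delta> else 1 - 6 * \<delta>)"

definition colour_kernel :: "nat \<Rightarrow> nat \<Rightarrow> real" where
  "colour_kernel i j = (\<Sum>l<3. colour_vec i l * colour_vec j l)"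

lemma colour_kernel_eq: "colour_kernel i j = 1 + colour_x i * colour_x j + colour_y i * colour_y j"
  by (simp add: colour_kernel_def colour_vec_def numeral_3_eq_3)

lemma colour_kernel_six: "colour_kernel 6 i = 1" "colour_kernel i 6 = 1"
  by (simp_all add: colour_kernel_eq colour_x_def colour_y_def)

lemma gram_colour_vec: "p \<noteq> q \<Longrightarrow> gram {..<3} colour_vec c {p, q} = colour_kernel (c p) (c q)"
  by (simp add: gram_pair colour_kernel_def)

lemma atMost_6: "{..6} = {0, 1, 2, 3, 4, 5, 6::nat}"
  by auto

lemma lessThan_6: "{..<6} = {0, 1, 2, 3, 4, 5::nat}"
  by auto

lemma psi_six: "psi 6 = 0"
  by (simp add: psi_def)

lemma sum_psi: "(\<Sum>i\<le>6. psi i) = 0"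
  by (simp add: atMost_6 psi_def)

text \<open>The kernel is affine in the point \<open>i\<close>, and \<open>psi\<close> has total
  mass and first moments zero.\<close>

lemma sum_psi_colour_kernel:
  assumes "k \<le> 6"
  shows "(\<Sum>i\<le>6. psi i * colour_kernel i k) = 0"
  using assms by (simp add: atMost_6 psi_def colour_kernel_eq colour_x_def colour_y_def)

lemma colour_values:
  "colour_x 0 = 2" "colour_x 1 = -2" "colour_x 2 = 0" "colour_x 3 = 0" "colour_x 4 = 4"
  "colour_x 5 = -4" "colour_x 6 = 0"
  "colour_y 0 = 0" "colour_y 1 = 0" "colour_y 2 = 2" "colour_y 3 = -2" "colour_y 4 = 2"
  "colour_y 5 = 2" "colour_y 6 = 0"
  "psi 0 = 1" "psi 1 = 1" "psi 2 = -1" "psi 3 = -1" "psi 4 = 0" "psi 5 = 0" "psi 6 = 0"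
  by (simp_all add: colour_x_def colour_y_def psi_def)

text \<open>In the product of two affine functions only the quadratic part survives, and the second
  moments of \<open>psi\<close> are 8 for xx, -8 for yy and 0 for xy.\<close>

lemma sum_psi_colour_kernel_mult:
  "(\<Sum>i\<le>6. psi i * (colour_kernel i k * colour_kernel i l)) =
    8 * (colour_x k * colour_x l - colour_y k * colour_y l)"
  by (simp add: atMost_6 colour_values colour_values[unfolded One_nat_def] colour_kernel_eq algebra_simps)

text \<open>Expanding the square turns the sum into products of moments of the six points. The
  nonzero ones are 40 for xx, 16 for yy, 64 for xxy and 16 for yyy. Up to the factor 64 the total is
  (40^2 + 16^2) - 2 * 64^2 + (64^2 + 16^2) = -1984; the negative term pairs the x-part of the kernel
  with the cross term of the square.\<close>

lemma second_order_negative: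
  "(\<Sum>k<6. \<Sum>l<6. colour_kernel k l *
      (\<Sum>i\<le>6. psi i * (colour_kernel i k * colour_kernel i l))\<^sup>2) < 0"
  unfolding sum_psi_colour_kernel_mult by (simp add: lessThan_6 colour_kernel_eq colour_x_def colour_y_def)

section \<open>The derivative for small masses\<close>

definition active :: "'a set \<Rightarrow> ('a \<Rightarrow> nat) \<Rightarrow> 'a set" where
  "active V c = {w \<in> V. c w \<noteq> 6}"

definition psi_sum :: "'a set \<Rightarrow> ('a \<Rightarrow> nat) \<Rightarrow> real" where
  "psi_sum V c = (\<Sum>i\<le>6. psi i * (\<Prod>w\<in>V. colour_kernel i (c w)))"

definition clique_weight :: "'a set \<Rightarrow> ('a \<Rightarrow> nat) \<Rightarrow> real" where
  "clique_weight V c = (\<Prod>e\<in>pairs V. gram {..<3} colour_vec c e)"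

lemma finite_active: "finite V \<Longrightarrow> finite (active V c)"
  by (simp add: active_def)

lemma psi_sum_active:
  assumes "finite V"
  shows "psi_sum V c = (\<Sum>i\<le>6. psi i * (\<Prod>w\<in>active V c. colour_kernel i (c w)))"
proof -
  have "(\<Prod>w\<in>V. colour_kernel i (c w)) = (\<Prod>w\<in>active V c. colour_kernel i (c w))" for i
    using assms by (intro prod.mono_neutral_right) (auto simp: active_def colour_kernel_six)
  then show ?thesis
    by (simp only: psi_sum_def)
qed

text \<open>Vertices at the origin contribute the factor 1, so at most one kernel factor remains,
  and \<open>psi\<close> annihilates constants and affine functions.\<close>

lemma psi_sum_eq_0:
  assumes V: "finite V" and c: "c \<in> V \<rightarrow>\<^sub>E {..6}" and card: "card (active V c) < 2"
  shows "psi_sum V c = 0"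
proof (cases "active V c = {}")
  case True
  then show ?thesis
    using V by (simp add: psi_sum_active sum_psi)
next
  case False
  then have "card (active V c) = 1"
    using card V finite_active[of V c] by (metis card_0_eq less_2_cases One_nat_def)
  then obtain w where w: "active V c = {w}"
    by (rule card_1_singletonE)
  then have "w \<in> V"
    by (auto simp: active_def)
  then have "c w \<le> 6"
    using c by auto
  then show ?thesis
    using V by (simp add: psi_sum_active w sum_psi_colour_kernel)
qed

lemma prod_colour_weight:
  assumes V: "finite V" and c: "c \<in> V \<rightarrow>\<^sub>E {..6}"
  shows "(\<Prod>u\<in>V. colour_weight \<delta> (c u)) = \<delta> ^ card (active V c) * (1 - 6 * \<delta>) ^ card (V - active V c)"
proof -
  have "V = active V c \<union> (V - active V c)"
    by (auto simp: active_def)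
  then have "(\<Prod>u\<in>V. colour_weight \<delta> (c u)) =
      (\<Prod>u\<in>active V c. colour_weight \<delta> (c u)) * (\<Prod>u\<in>V - active V c. colour_weight \<delta> (c u))"
    using V finite_active[OF V] by (metis prod.union_disjoint Diff_disjoint finite_Diff)
  also have "(\<Prod>u\<in>active V c. colour_weight \<delta> (c u)) = (\<Prod>u\<in>active V c. \<delta>)"
    using c by (intro prod.cong) (auto simp: active_def colour_weight_def PiE_iff order_less_le)
  also have "(\<Prod>u\<in>V - active V c. colour_weight \<delta> (c u)) = (\<Prod>u\<in>V - active V c. 1 - 6 * \<delta>)"
    by (intro prod.cong) (auto simp: active_def colour_weight_def)
  finally show ?thesis
    by simp
qed

text \<open>The only colour whose mass is not \<delta> is the origin, where \<open>psi\<close>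
  vanishes.\<close>

lemma sum_colour_weight_psi:
  "(\<Sum>i\<le>6. colour_weight \<delta> i * psi i * f i) = \<delta> * (\<Sum>i\<le>6. psi i * f i)"
proof -
  have "colour_weight \<delta> i * psi i * f i = \<delta> * (psi i * f i)" if "i \<le> 6" for i
    using that psi_six by (cases "i = 6") (simp_all add: colour_weight_def)
  then show ?thesis
    unfolding sum_distrib_left by (intro sum.cong) auto
qed

text \<open>Every other edge has an end at the origin, where the kernel is 1.\<close>

lemma clique_weight_active_pair:
  assumes V: "finite V" and a: "active V c = {p, q}" "p \<noteq> q"
  shows "clique_weight V c = colour_kernel (c p) (c q)"
proof -
  have "{p, q} \<subseteq> V"
    using a by (auto simp: active_def)
  then have pq: "{p, q} \<in> pairs V"
    using a by (auto intro: pairsI)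
  have "gram {..<3} colour_vec c e = 1" if e: "e \<in> pairs V" "e \<noteq> {p, q}" for e
  proof -
    obtain x y where xy: "e = {x, y}" "x \<noteq> y" "x \<in> V" "y \<in> V"
      using e(1) by (rule pairsE)
    then have "x \<notin> active V c \<or> y \<notin> active V c"
      using e(2) a by auto
    then have "c x = 6 \<or> c y = 6"
      using xy by (auto simp: active_def)
    then show ?thesis
      using xy by (auto simp: gram_colour_vec colour_kernel_six)
  qed
  then have "clique_weight V c = (\<Prod>e\<in>{{p, q}}. gram {..<3} colour_vec c e)"
    unfolding clique_weight_def using V pq by (intro prod.mono_neutral_right) (auto simp: finite_pairs)
  then show ?thesis
    using a by (simp add: gram_colour_vec)
qed

text \<open>Such a colouring amounts to two colours other than the origin, one for each element of
  \<open>P\<close>, and the summand depends on these alone. The value is therefore the same for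
  every pair \<open>P\<close>.\<close>

lemma sum_two_active:
  fixes V :: "'a set"
  assumes V: "finite V" and P: "P \<in> pairs V"
  shows "(\<Sum>c | c \<in> V \<rightarrow>\<^sub>E {..6} \<and> active V c = P. clique_weight V c * (psi_sum V c)\<^sup>2) =
    (\<Sum>k<6. \<Sum>l<6. colour_kernel k l *
      (\<Sum>i\<le>6. psi i * (colour_kernel i k * colour_kernel i l))\<^sup>2)"
proof -
  obtain p q where pq: "P = {p, q}" "p \<noteq> q" "p \<in> V" "q \<in> V"
    using P by (rule pairsE)
  define col where "col = (\<lambda>(i, j). \<lambda>x\<in>V. if x = p then i else if x = q then j else (6::nat))"
  have "(\<Sum>c | c \<in> V \<rightarrow>\<^sub>E {..6} \<and> active V c = P. clique_weight V c * (psi_sum V c)\<^sup>2) =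
    (\<Sum>(k, l)\<in>{..<6} \<times> {..<6}. colour_kernel k l *
      (\<Sum>i\<le>6. psi i * (colour_kernel i k * colour_kernel i l))\<^sup>2)"
  proof (rule sum.reindex_bij_witness[of _ col "\<lambda>c. (c p, c q)"])
    fix c assume c: "c \<in> {c. c \<in> V \<rightarrow>\<^sub>E {..6} \<and> active V c = P}"
    then have act: "active V c = {p, q}" and c': "c \<in> V \<rightarrow>\<^sub>E {..6}"
      using pq by auto
    have out: "c x = 6" if "x \<in> V" "x \<noteq> p" "x \<noteq> q" for x
      using act that by (auto simp: active_def)
    have "c p \<noteq> 6" "c q \<noteq> 6"
      using act by (auto simp: active_def)
    moreover have "c p \<le> 6" "c q \<le> 6"
      using c' pq by auto
    ultimately show "(c p, c q) \<in> {..<6} \<times> {..<6}"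
      by auto
    show "col (c p, c q) = c"
      using c' out by (auto simp: col_def fun_eq_iff PiE_iff extensional_def)
    show "(case (c p, c q) of (k, l) \<Rightarrow> colour_kernel k l *
      (\<Sum>i\<le>6. psi i * (colour_kernel i k * colour_kernel i l))\<^sup>2) =
        clique_weight V c * (psi_sum V c)\<^sup>2"
      using clique_weight_active_pair[OF V act pq(2)] psi_sum_active[OF V, of c] act pq(2) by simp
  next
    fix k assume k: "k \<in> {..<6::nat} \<times> {..<6::nat}"
    show "(col k p, col k q) = k"
      using pq by (auto simp: col_def split: prod.split)
    show "col k \<in> {c. c \<in> V \<rightarrow>\<^sub>E {..6} \<and> active V c = P}"
      using k pq by (auto simp: col_def active_def split: if_splits)
  qed
  then show ?thesis
    by (simp add: sum.cartesian_product)
qed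

text \<open>Here \<open>V\<close> consists of the vertices off one edge. A colouring with m active
  vertices has order m + 2 in \<delta>, and it contributes nothing if m < 2. After division by
  \<open>\<delta> ^ 4\<close> the limit at 0 is the negative constant of
  \<open>second_order_negative\<close> times the number of pairs in \<open>V\<close>, of which there
  is at least one.\<close>

lemma edge_derivative_negative:
  fixes V :: "'a set"
  assumes V: "finite V" and card: "card V \<ge> 2"
  shows "\<forall>\<^sub>F \<delta> in at_right 0. (\<Sum>c\<in>V \<rightarrow>\<^sub>E {..6}. (\<Prod>u\<in>V. colour_weight \<delta> (c u)) * clique_weight V c *
     (\<Sum>i\<le>6. colour_weight \<delta> i * psi i * (\<Prod>w\<in>V. colour_kernel i (c w)))\<^sup>2) < 0"
proof -
  \<comment> \<open>The truncated subtraction is harmless: where fewer than two vertices are active,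
    \<open>psi_sum\<close> is zero.\<close>
  define h where "h = (\<lambda>\<delta>. \<Sum>c\<in>V \<rightarrow>\<^sub>E {..6}.
    \<delta> ^ (card (active V c) - 2) * (1 - 6 * \<delta>) ^ card (V - active V c) * (clique_weight V c * (psi_sum V c)\<^sup>2))"
  let ?X = "\<Sum>k<6. \<Sum>l<6. colour_kernel k l * (\<Sum>i\<le>6. psi i * (colour_kernel i k * colour_kernel i l))\<^sup>2"
  have fin: "finite (V \<rightarrow>\<^sub>E {..6::nat})"
    using V by (simp add: finite_PiE)
  have eq: "(\<Sum>c\<in>V \<rightarrow>\<^sub>E {..6}. (\<Prod>u\<in>V. colour_weight \<delta> (c u)) * clique_weight V c *
     (\<Sum>i\<le>6. colour_weight \<delta> i * psi i * (\<Prod>w\<in>V. colour_kernel i (c w)))\<^sup>2) = \<delta> ^ 4 * h \<delta>" for \<delta>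
    unfolding h_def sum_distrib_left
  proof (intro sum.cong refl)
    fix c assume c: "c \<in> V \<rightarrow>\<^sub>E {..6::nat}"
    have *: "(\<Sum>i\<le>6. colour_weight \<delta> i * psi i * (\<Prod>w\<in>V. colour_kernel i (c w))) = \<delta> * psi_sum V c"
      unfolding psi_sum_def by (rule sum_colour_weight_psi)
    show "(\<Prod>u\<in>V. colour_weight \<delta> (c u)) * clique_weight V c *
     (\<Sum>i\<le>6. colour_weight \<delta> i * psi i * (\<Prod>w\<in>V. colour_kernel i (c w)))\<^sup>2 = \<delta> ^ 4 *
      (\<delta> ^ (card (active V c) - 2) * (1 - 6 * \<delta>) ^ card (V - active V c) * (clique_weight V c * (psi_sum V c)\<^sup>2))"
    proof (cases "card (active V c) < 2")
      case True
      then show ?thesis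
        using psi_sum_eq_0[OF V c] unfolding * by simp
    next
      case False
      then have "\<delta> ^ card (active V c) * \<delta>\<^sup>2 = \<delta> ^ 4 * \<delta> ^ (card (active V c) - 2)"
        by (simp flip: power_add)
      then show ?thesis
        unfolding * prod_colour_weight[OF V c] power_mult_distrib by (simp add: mult_ac)
    qed
  qed
  \<comment> \<open>At 0 the power of \<delta> vanishes for more than two active vertices and is 1
    for exactly two.\<close>
  have "h 0 = (\<Sum>c\<in>V \<rightarrow>\<^sub>E {..6}. if card (active V c) = 2 then clique_weight V c * (psi_sum V c)\<^sup>2 else 0)"
    unfolding h_def using V psi_sum_eq_0[OF V]
    by (intro sum.cong refl) (auto simp: power_0_left not_le linorder_neq_iff)
  also have "\<dots> = (\<Sum>c | c \<in> V \<rightarrow>\<^sub>E {..6} \<and> card (active V c) = 2. clique_weight V c * (psi_sum V c)\<^sup>2)"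
    using fin by (simp add: sum.inter_filter)
  also have "\<dots> = (\<Sum>P\<in>pairs V. \<Sum>c\<in>{c \<in> {c. c \<in> V \<rightarrow>\<^sub>E {..6} \<and> card (active V c) = 2}. active V c = P}.
      clique_weight V c * (psi_sum V c)\<^sup>2)"
    using fin V by (intro sum.group[symmetric]) (auto simp: finite_pairs pairs_def active_def)
  also have "\<dots> = (\<Sum>P\<in>pairs V. ?X)"
  proof (intro sum.cong refl)
    fix P assume P: "P \<in> pairs V"
    have "{c \<in> {c. c \<in> V \<rightarrow>\<^sub>E {..6} \<and> card (active V c) = 2}. active V c = P} =
        {c. c \<in> V \<rightarrow>\<^sub>E {..6} \<and> active V c = P}"
      using P by (auto simp: pairs_def)
    then show "(\<Sum>c\<in>{c \<in> {c. c \<in> V \<rightarrow>\<^sub>E {..6} \<and> card (active V c) = 2}. active V c = P}.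
      clique_weight V c * (psi_sum V c)\<^sup>2) = ?X"
      using sum_two_active[OF V P] by simp
  qed
  also have "\<dots> < 0"
  proof -
    obtain P where "P \<subseteq> V" "card P = 2"
      using card by (meson obtain_subset_with_card_n)
    then have "P \<in> pairs V"
      by (simp add: pairs_def)
    then have "card (pairs V) > 0"
      using V by (auto simp: card_gt_0_iff finite_pairs)
    then show ?thesis
      using second_order_negative by (simp add: mult_pos_neg)
  qed
  finally have "h 0 < 0" .
  moreover have "isCont h 0"
    unfolding h_def by (intro continuous_intros)
  ultimately have "\<forall>\<^sub>F \<delta> in at 0. h \<delta> < 0"
    by (simp add: isCont_def order_tendstoD)
  then have "\<forall>\<^sub>F \<delta> in at_right 0. h \<delta> < 0"
    by (rule filter_leD[OF at_le, rotated]) simp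
  moreover have "\<forall>\<^sub>F \<delta> in at_right (0::real). \<delta> > 0"
    by (rule eventually_at_right_less)
  ultimately show ?thesis
    by eventually_elim (simp add: eq mult_pos_neg)
qed

text \<open>At \<delta> = 0 all mass sits at the origin, where the kernel is 1, so the density is 1;
  continuity does the rest.\<close>

lemma clique_density_positive:
  assumes V: "finite V"
  shows "\<forall>\<^sub>F \<delta> in at_right 0. (\<Sum>c\<in>V \<rightarrow>\<^sub>E {..6}. (\<Prod>u\<in>V. colour_weight \<delta> (c u)) * clique_weight V c) > 0"
proof -
  define h where "h = (\<lambda>\<delta>. \<Sum>c\<in>V \<rightarrow>\<^sub>E {..6}. (\<Prod>u\<in>V. colour_weight \<delta> (c u)) * clique_weight V c)"
  define c0 where "c0 = (\<lambda>u\<in>V. 6::nat)"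
  have "(\<Prod>u\<in>V. colour_weight 0 (c u)) * clique_weight V c = (if c = c0 then clique_weight V c else 0)"
    if c: "c \<in> V \<rightarrow>\<^sub>E {..6}" for c
  proof (cases "c = c0")
    case False
    moreover have "c0 \<in> V \<rightarrow>\<^sub>E {..6}"
      by (simp add: c0_def)
    ultimately obtain u where u: "u \<in> V" "c u \<noteq> 6"
      using PiE_ext[OF c, of c0] by (auto simp: c0_def)
    moreover have "c u \<le> 6"
      using c u by auto
    ultimately have "u \<in> V" "c u < 6"
      by auto
    then show ?thesis
      using V False by (auto simp: colour_weight_def intro!: prod_zero)
  qed (simp add: c0_def colour_weight_def)
  then have "h 0 = (\<Sum>c\<in>V \<rightarrow>\<^sub>E {..6}. if c = c0 then clique_weight V c else 0)"
    unfolding h_def by (intro sum.cong) auto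
  also have "\<dots> = clique_weight V c0"
    using V by (subst sum.delta) (auto simp: finite_PiE c0_def)
  also have "\<dots> = (\<Prod>e\<in>pairs V. 1)"
    unfolding clique_weight_def by (intro prod.cong) (auto elim!: pairsE simp: gram_colour_vec c0_def colour_kernel_six)
  finally have "h 0 > 0"
    by simp
  moreover have "isCont (\<lambda>\<delta>. colour_weight \<delta> i) 0" for i
    by (cases "i < 6") (auto simp: colour_weight_def intro!: continuous_intros)
  then have "isCont h 0"
    unfolding h_def by (intro continuous_intros)
  ultimately have "\<forall>\<^sub>F \<delta> in at 0. h \<delta> > 0"
    by (simp add: isCont_def order_tendstoD)
  then have "\<forall>\<^sub>F \<delta> in at_right 0. h \<delta> > 0"
    by (rule filter_leD[OF at_le, rotated]) simp
  then show ?thesis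
    by (simp add: h_def)
qed

section \<open>Violation of the triangle inequality\<close>

text \<open>
  The factor \<open>2\<close> compensates for the four cells in \<open>y\<close>, each of length \<open>1/4\<close>.
\<close>

definition step_value :: "real \<Rightarrow> nat \<Rightarrow> nat \<Rightarrow> real" where
  "step_value r i j = 2 * (if j < 3 then colour_vec i j else r * psi i)"

definition step_fun :: "real \<Rightarrow> real \<Rightarrow> real \<times> real \<Rightarrow> real" where
  "step_fun \<delta> r = (\<lambda>(x, y). step_value r (cell 6 \<delta> x) (cell 3 (1/4) y))"

text \<open>The density of the complete graph in the Gram kernel perturbed by \<open>s\<close> times
  the tensor square of \<open>psi\<close>.\<close>

definition clique_density :: "nat \<Rightarrow> real \<Rightarrow> real \<Rightarrow> real" where
  "clique_density n \<delta> s = (\<Sum>c\<in>{..<n} \<rightarrow>\<^sub>E {..6}. (\<Prod>u<n. colour_weight \<delta> (c u)) *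
     (\<Prod>e\<in>pairs {..<n}. gram {..<3} colour_vec c e + s * (\<Prod>u\<in>e. psi (c u))))"

text \<open>A subdividing vertex has exactly two neighbours, so summing over its cell gives a kernel
  value at the colours of the two ends. The last cell contributes one factor \<open>r\<close> per
  end; hence only \<open>r\<^sup>2\<close> appears and the sign of \<open>r\<close> is lost.\<close>

lemma hom_density_step_subdivision:
  assumes "0 < \<delta>" "6 * \<delta> \<le> 1"
  shows "hom_density (one_subdivision (complete_graph n)) (step_fun \<delta> r) = clique_density n \<delta> (r\<^sup>2)"
proof -
  let ?H = "one_subdivision (complete_graph n)"
  have H: "lverts ?H = {..<n}" "rverts ?H = pairs {..<n}"
    "biedges ?H = {(v, e). e \<in> pairs {..<n} \<and> v \<in> e}"
    by (simp_all add: one_subdivision_def complete_graph_def pairs_def)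
  have a: "measure (lebesgue_on {0..1}) (cell 6 \<delta> -` {i} \<inter> {0..1}) = colour_weight \<delta> i" if "i \<le> 6" for i
    using measure_cell[of \<delta> 6 i] assms that by (simp add: colour_weight_def)
  have b: "measure (lebesgue_on {0..1}) (cell 3 (1/4) -` {j} \<inter> {0..1}) = 1/4" if "j \<le> 3" for j
    using measure_cell[of "1/4" 3 j] that by simp
  have "hom_density ?H (step_fun \<delta> r) = (\<Sum>c\<in>lverts ?H \<rightarrow>\<^sub>E {..6}.
      (\<Prod>u\<in>lverts ?H. measure (lebesgue_on {0..1}) (cell 6 \<delta> -` {c u} \<inter> {0..1})) *
      (\<Prod>e\<in>rverts ?H. \<Sum>j\<le>3. measure (lebesgue_on {0..1}) (cell 3 (1/4) -` {j} \<inter> {0..1}) *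
         (\<Prod>u | (u, e) \<in> biedges ?H. step_value r (c u) j)))"
    unfolding step_fun_def
    by (intro hom_density_step bigraph_wf_one_subdivision_complete cell_measurable) auto
  also have "\<dots> = clique_density n \<delta> (r\<^sup>2)"
    unfolding H clique_density_def
  proof (intro sum.cong arg_cong2[where f = "(*)"] prod.cong refl)
    fix c u assume "c \<in> {..<n} \<rightarrow>\<^sub>E {..6::nat}" "u \<in> {..<n}"
    then show "measure (lebesgue_on {0..1}) (cell 6 \<delta> -` {c u} \<inter> {0..1}) = colour_weight \<delta> (c u)"
      by (intro a) auto
  next
    fix c :: "nat \<Rightarrow> nat" and e assume e: "e \<in> pairs {..<n}"
    then obtain p q where pq: "e = {p, q}" "p \<noteq> q"
      by (auto elim: pairsE)
    have 3: "{..3} = {0, 1, 2, 3::nat}" "{..<3} = {0, 1, 2::nat}"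
      by auto
    have ends: "{u. (u, e) \<in> {(v, e). e \<in> pairs {..<n} \<and> v \<in> e}} = e"
      using e by auto
    have "(\<Sum>j\<le>3. measure (lebesgue_on {0..1}) (cell 3 (1/4) -` {j} \<inter> {0..1}) *
        (\<Prod>u\<in>e. step_value r (c u) j)) = (\<Sum>j\<le>3. 1/4 * (\<Prod>u\<in>e. step_value r (c u) j))"
      by (intro sum.cong refl arg_cong2[where f = "(*)"] b) simp
    then show "(\<Sum>j\<le>3. measure (lebesgue_on {0..1}) (cell 3 (1/4) -` {j} \<inter> {0..1}) *
        (\<Prod>u | (u, e) \<in> {(v, e). e \<in> pairs {..<n} \<and> v \<in> e}. step_value r (c u) j)) =
        gram {..<3} colour_vec c e + r\<^sup>2 * (\<Prod>u\<in>e. psi (c u))"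
      unfolding ends using pq by (simp add: step_value_def 3 gram_pair power2_eq_square)
  qed
  finally show ?thesis .
qed

text \<open>First \<delta> is fixed so small that every edge contributes negatively to the
  derivative at \<open>s = 0\<close> and the density there is positive; then \<open>s\<close> is
  taken small enough for both to persist.\<close>

lemma clique_density_decreases:
  assumes "n > 3"
  obtains \<delta> s where "0 < \<delta>" "6 * \<delta> \<le> 1" "0 < s" "0 < clique_density n \<delta> s"
    "clique_density n \<delta> s < clique_density n \<delta> 0"
proof -
  define V where "V = {..<n}"
  have V: "finite V" "card V = n"
    by (simp_all add: V_def)
  define D where "D = (\<lambda>\<delta> e. \<Sum>c\<in>V \<rightarrow>\<^sub>E {..6}. (\<Prod>u\<in>V. colour_weight \<delta> (c u)) *
      ((\<Prod>u\<in>e. psi (c u)) * (\<Prod>e'\<in>pairs V - {e}. gram {..<3} colour_vec c e')))"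
  have "\<forall>\<^sub>F \<delta> in at_right 0. D \<delta> e < 0" if e: "e \<in> pairs V" for e
  proof -
    \<comment> \<open>This is where \<open>n > 3\<close> enters: two vertices must remain besides
      the ends of the edge.\<close>
    have "card (V - e) = n - 2"
      using e V by (subst card_Diff_subset) (auto simp: pairs_def intro: card_ge_0_finite)
    then have "\<forall>\<^sub>F \<delta> in at_right 0. (\<Sum>c\<in>V - e \<rightarrow>\<^sub>E {..6}. (\<Prod>u\<in>V - e. colour_weight \<delta> (c u)) *
      clique_weight (V - e) c * (\<Sum>i\<le>6. colour_weight \<delta> i * psi i * (\<Prod>w\<in>V - e. colour_kernel i (c w)))\<^sup>2) < 0"
      using assms V by (intro edge_derivative_negative) auto
    then show ?thesis
      unfolding D_def sum_delete_edge[OF V(1) e] clique_weight_def colour_kernel_def .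
  qed
  then have "\<forall>\<^sub>F \<delta> in at_right 0. \<forall>e\<in>pairs V. D \<delta> e < 0"
    using V by (intro eventually_ball_finite finite_pairs) auto
  moreover have "\<forall>\<^sub>F \<delta> in at_right 0. clique_density n \<delta> 0 > 0"
    using clique_density_positive[OF V(1)] by (simp add: clique_density_def clique_weight_def V_def)
  moreover have "\<forall>\<^sub>F \<delta> in at_right 0. \<delta> \<in> {0<..<1/6::real}"
    by (rule eventually_at_right_real) simp
  ultimately have "\<forall>\<^sub>F \<delta> in at_right 0. (\<forall>e\<in>pairs V. D \<delta> e < 0) \<and> clique_density n \<delta> 0 > 0 \<and> \<delta> \<in> {0<..<1/6}"
    by eventually_elim simp
  then obtain \<delta> where D: "\<And>e. e \<in> pairs V \<Longrightarrow> D \<delta> e < 0" and pos: "clique_density n \<delta> 0 > 0"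
      and \<delta>: "0 < \<delta>" "\<delta> < 1/6"
    by (auto dest!: eventually_happens' [rotated])
  have deriv: "(clique_density n \<delta> has_real_derivative (\<Sum>e\<in>pairs V. D \<delta> e)) (at 0)"
  proof -
    have "((\<lambda>s. \<Prod>e\<in>pairs V. gram {..<3} colour_vec c e + s * (\<Prod>u\<in>e. psi (c u))) has_real_derivative
       (\<Sum>e\<in>pairs V. (\<Prod>u\<in>e. psi (c u)) * (\<Prod>e'\<in>pairs V - {e}. gram {..<3} colour_vec c e' + 0 * (\<Prod>u\<in>e'. psi (c u)))))
       (at 0)" for c
      by (rule has_field_derivative_prod) (auto intro!: derivative_eq_intros)
    then have "(clique_density n \<delta> has_real_derivative (\<Sum>c\<in>V \<rightarrow>\<^sub>E {..6}. (\<Prod>u\<in>V. colour_weight \<delta> (c u)) *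
       (\<Sum>e\<in>pairs V. (\<Prod>u\<in>e. psi (c u)) * (\<Prod>e'\<in>pairs V - {e}. gram {..<3} colour_vec c e')))) (at 0)"
      unfolding clique_density_def V_def by (intro DERIV_sum DERIV_cmult) simp
    also have "(\<Sum>c\<in>V \<rightarrow>\<^sub>E {..6}. (\<Prod>u\<in>V. colour_weight \<delta> (c u)) *
       (\<Sum>e\<in>pairs V. (\<Prod>u\<in>e. psi (c u)) * (\<Prod>e'\<in>pairs V - {e}. gram {..<3} colour_vec c e'))) =
       (\<Sum>e\<in>pairs V. D \<delta> e)"
      unfolding D_def sum_distrib_left by (rule sum.swap)
    finally show ?thesis .
  qed
  have "pairs V \<noteq> {}"
    using assms pairsI[of 0 V 1] by (auto simp: V_def)
  then have "(\<Sum>e\<in>pairs V. D \<delta> e) < 0"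
    using sum_strict_mono[of "pairs V" "D \<delta>" "\<lambda>_. 0"] D V by (simp add: finite_pairs)
  from DERIV_neg_dec_right[OF deriv this] obtain d
    where d: "d > 0" "\<And>h. 0 < h \<Longrightarrow> h < d \<Longrightarrow> clique_density n \<delta> h < clique_density n \<delta> 0"
    by auto
  \<comment> \<open>Positivity at \<open>s\<close> lets the absolute values in the norm be
    dropped.\<close>
  have "\<forall>\<^sub>F s in at 0. clique_density n \<delta> s > 0"
    using DERIV_isCont[OF deriv] pos by (simp add: isCont_def order_tendstoD)
  then have "\<forall>\<^sub>F s in at_right 0. clique_density n \<delta> s > 0"
    by (rule filter_leD[OF at_le, rotated]) simp
  moreover have "\<forall>\<^sub>F s in at_right 0. s \<in> {0<..<d}"
    by (rule eventually_at_right_real) (fact d)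
  ultimately have "\<forall>\<^sub>F s in at_right 0. clique_density n \<delta> s > 0 \<and> s \<in> {0<..<d}"
    by eventually_elim simp
  then obtain s where "clique_density n \<delta> s > 0" "0 < s" "s < d"
    by (auto dest!: eventually_happens' [rotated])
  then show ?thesis
    using that[of \<delta> s] \<delta> d by auto
qed

theorem theorem6p6:
  fixes n :: nat
  assumes "n > 3"
  shows "\<not> norming (one_subdivision (complete_graph n))"
proof
  let ?H = "one_subdivision (complete_graph n)"
  assume "norming ?H"
  then have hom: "\<And>f c. f \<in> bounded_measurable \<Longrightarrow> graph_norm ?H (\<lambda>p. c * f p) = \<bar>c\<bar> * graph_norm ?H f"
    and triangle: "\<And>f g. f \<in> bounded_measurable \<Longrightarrow> g \<in> bounded_measurable \<Longrightarrow>
      graph_norm ?H (\<lambda>p. f p + g p) \<le> graph_norm ?H f + graph_norm ?H g"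
    by (auto simp: norming_def seminorm_on_def)
  obtain \<delta> s where \<delta>: "0 < \<delta>" "6 * \<delta> \<le> 1" and s: "0 < s" "0 < clique_density n \<delta> s"
      "clique_density n \<delta> s < clique_density n \<delta> 0"
    using clique_density_decreases[OF assms] .
  define t where "t = 1 / real (card (biedges ?H))"
  \<comment> \<open>An edge makes the exponent positive; \<open>1 / 0 = 0\<close> would destroy the
    strict comparison of powers.\<close>
  have "(0, {0, 1}) \<in> biedges ?H"
    using assms by (simp add: one_subdivision_def complete_graph_def)
  moreover have "finite (biedges ?H)"
    using bigraph_wf_one_subdivision_complete[of n]
    by (auto simp: bigraph_wf_def intro: finite_subset)
  ultimately have t: "t > 0"
    by (auto simp: t_def card_gt_0_iff)
  have step: "step_fun \<delta> r \<in> bounded_measurable" for r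
    unfolding step_fun_def by (rule cell_step_bounded_measurable)
  have norm: "graph_norm ?H (step_fun \<delta> r) = \<bar>clique_density n \<delta> (r\<^sup>2)\<bar> powr t" for r
    using \<delta> by (simp add: graph_norm_def hom_density_step_subdivision t_def)
  have "2 * graph_norm ?H (step_fun \<delta> 0) = graph_norm ?H (\<lambda>p. 2 * step_fun \<delta> 0 p)"
    using hom[OF step, of 2] by simp
  \<comment> \<open>In the last cell of y the two signs cancel; in the other three the summands
    agree and add up to twice the unperturbed function.\<close>
  also have "(\<lambda>p. 2 * step_fun \<delta> 0 p) = (\<lambda>p. step_fun \<delta> (sqrt s) p + step_fun \<delta> (- sqrt s) p)"
    by (auto simp: step_fun_def step_value_def)
  also have "graph_norm ?H \<dots> \<le> graph_norm ?H (step_fun \<delta> (sqrt s)) + graph_norm ?H (step_fun \<delta> (- sqrt s))"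
    by (intro triangle step)
  \<comment> \<open>Both summands on the right have density
    \<open>clique_density n \<delta> s\<close>, since their parameters have the same square.\<close>
  finally have "\<bar>clique_density n \<delta> 0\<bar> powr t \<le> \<bar>clique_density n \<delta> s\<bar> powr t"
    using s by (simp add: norm)
  moreover have "\<bar>clique_density n \<delta> s\<bar> powr t < \<bar>clique_density n \<delta> 0\<bar> powr t"
    using s t by (intro powr_less_mono2) auto
  ultimately show False
    by simp
qed

end
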